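(* Let $T$ be a weighted process tree of size $|T|$ and run on $T$ the random run generation algorithm described in the context. Let $\sigma_p=\langle\alpha_1,\dots,\alpha_p\rangle$ be the prefix obtained at (the end of) the $p$-th step, $1\le p<|T|$. Conditionally on $\sigma_p$, the next action $\alpha_{p+1}$ is chosen with probability $|T(\alpha_{p+1})|/(|T|-p)$. Consequently the complete run $\sigma$ is generated with uniform probability among all concurrent runs of $T$.
   Context: A process tree is a plane rooted tree $T$ whose nodes carry pairwise distinct names (actions); its size $|T|$ is its number of nodes; $T(v)$ is the subtree of all descendants of the node $v$ (including $v$). "Weighted" means that each node $v$ stores the integer $|T(v)|$. For $T$ whose root has children $v_1,\dots,v_r$ from left to right, and $1\le i\le r$, the $i$-contraction $T\lhd i$ is the plane tree with root $v_i$ whose root-subtrees are, from left to right, $T(v_1),\dots,T(v_{i-1}),T(v_{i_1}),\dots,T(v_{i_m}),T(v_{i+1}),\dots,T(v_r)$, where $v_{i_1},\dots,v_{i_m}$ are the children of $v_i$ in order. The semantic tree $\mathrm{Sem}(T)$ is: $T$ itself if $T$ is a single node; otherwise the tree with the root $t$ of $T$ as root and root-subtrees $\mathrm{Sem}(T\lhd1),\dots,\mathrm{Sem}(T\lhd r)$. A concurrent run of $T$ is a branch (root-to-leaf path) of $\mathrm{Sem}(T)$. Algorithm. Maintain a sequence $\sigma$, initially empty, and a multiset $M$ of nodes of $T$ with non-negative integer weights $M(\cdot)$, initially containing only the root of $T$ with weight $|T|$. For $p=1,\dots,|T|$: sample an action $\alpha$ from $M$ with probability $M(\alpha)/|M|$,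 where $|M|=\sum_\beta M(\beta)$ (independently of the past given $M$); append $\alpha$ to $\sigma$; set the weight of $\alpha$ in $M$ to $0$; for each child $\beta$ of $\alpha$ in $T$, set the weight of $\beta$ in $M$ to $|T(\beta)|$. Return $\sigma$. *)

theory Defs
  imports "HOL-Probability.Probability"
begin

datatype 'a ptree = Node (action: 'a) (children: "'a ptree list")

fun subtrees :: "'a ptree \<Rightarrow> 'a ptree list" where
  "subtrees (Node a ts) = Node a ts # concat (map subtrees ts)"

definition nodes :: "'a ptree \<Rightarrow> 'a list" where
  "nodes T = map action (subtrees T)"

definition tree_size :: "'a ptree \<Rightarrow> nat" where
  "tree_size T = length (nodes T)"

text \<open>In a process tree the names are pairwise distinct, so a node is identified with its name
  (its action).\<close>

definition process_tree :: "'a ptree \<Rightarrow> bool" where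
  "process_tree T \<longleftrightarrow> distinct (nodes T)"

definition subtree_at :: "'a ptree \<Rightarrow> 'a \<Rightarrow> 'a ptree" where
  "subtree_at T v = (THE S. S \<in> set (subtrees T) \<and> action S = v)"

definition weight :: "'a ptree \<Rightarrow> 'a \<Rightarrow> nat" where
  "weight T v = tree_size (subtree_at T v)"

text \<open>The children of the root are numbered from \<open>0\<close>, so \<open>contract T i\<close> is the contraction of
  \<open>T\<close> at its \<open>(i + 1)\<close>-st child.\<close>

definition contract :: "'a ptree \<Rightarrow> nat \<Rightarrow> 'a ptree" where
  "contract T i =
     Node (action (children T ! i))
       (take i (children T) @ children (children T ! i) @ drop (Suc i) (children T))"

lemma tree_size_Node: "tree_size (Node a ts) = Suc (sum_list (map tree_size ts))"
  by (simp add: tree_size_def [abs_def] nodes_def length_concat comp_def)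

lemma tree_size_contract:
  assumes "i < length (children T)"
  shows "Suc (tree_size (contract T i)) = tree_size T"
proof -
  obtain a ts where T: "T = Node a ts" by (cases T)
  obtain b us where S: "ts ! i = Node b us" by (cases "ts ! i")
  have "ts = take i ts @ Node b us # drop (Suc i) ts"
    using assms T S id_take_nth_drop by fastforce
  then have "sum_list (map tree_size ts) =
      sum_list (map tree_size (take i ts)) + tree_size (Node b us) +
      sum_list (map tree_size (drop (Suc i) ts))"
    by (metis (no_types, lifting) add.assoc list.simps(9) map_append sum_list.Cons
        sum_list.append)
  then show ?thesis
    by (simp add: contract_def T S tree_size_Node)
qed

text \<open>For a one-node tree the list of children below is empty, so \<open>Sem T = T\<close>.\<close>

function Sem :: "'a ptree \<Rightarrow> 'a ptree" where
  "Sem T = Node (action T) (map (\<lambda>i. Sem (contract T i)) [0..<length (children T)])"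
  by auto
termination
  by (relation "Wellfounded.measure tree_size") (auto dest: tree_size_contract)

declare Sem.simps [simp del]

text \<open>Root-to-leaf paths, recorded as sequences of names.  The children of any node of the semantic
  tree of a process tree carry distinct names, so there different branches give different
  sequences.\<close>

fun branches :: "'a ptree \<Rightarrow> 'a list set" where
  "branches (Node a ts) = (if ts = [] then {[a]} else (\<Union>t\<in>set ts. (#) a ` branches t))"

definition concurrent_runs :: "'a ptree \<Rightarrow> 'a list set" where
  "concurrent_runs T = branches (Sem T)"

text \<open>The weighted multiset \<open>M\<close> of the algorithm is a multiset in which the weight of a node is its
  multiplicity; its total weight is \<open>size M\<close>, and \<open>pmf_of_multiset M\<close> draws \<open>\<alpha>\<close> with probability
  \<open>count M \<alpha> / size M\<close> (for nonempty \<open>M\<close>).\<close>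

definition set_weight :: "'a \<Rightarrow> nat \<Rightarrow> 'a multiset \<Rightarrow> 'a multiset" where
  "set_weight v w M = filter_mset (\<lambda>x. x \<noteq> v) M + replicate_mset w v"

definition update :: "'a ptree \<Rightarrow> 'a \<Rightarrow> 'a multiset \<Rightarrow> 'a multiset" where
  "update T \<alpha> M =
     fold (\<lambda>\<beta>. set_weight \<beta> (weight T \<beta>)) (map action (children (subtree_at T \<alpha>)))
       (set_weight \<alpha> 0 M)"

text \<open>The joint law of \<open>\<sigma>\<close> and \<open>M\<close> at the end of step \<open>p\<close>.\<close>

fun state_after :: "'a ptree \<Rightarrow> nat \<Rightarrow> ('a list \<times> 'a multiset) pmf" where
  "state_after T 0 = return_pmf ([], replicate_mset (tree_size T) (action T))"
| "state_after T (Suc p) =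
     bind_pmf (state_after T p) (\<lambda>(\<sigma>, M).
       map_pmf (\<lambda>\<alpha>. (\<sigma> @ [\<alpha>], update T \<alpha> M)) (pmf_of_multiset M))"

definition random_run :: "'a ptree \<Rightarrow> 'a list pmf" where
  "random_run T = map_pmf fst (state_after T (tree_size T))"

end

theory Submission
  imports Defs
begin

text \<open>After a nonempty prefix \<open>\<sigma>\<close> the algorithm has walked down a chain of contractions
  of \<open>T\<close> ending in some tree \<open>S\<close>, and \<open>M\<close> consists of the roots of the
  root-subtrees of \<open>S\<close>, weighted by their sizes.  These sizes add up to
  \<open>|T| - |\<sigma>|\<close>, which gives the transition probabilities.  In the probability of a
  complete run the denominators multiply to \<open>(|T| - 1)!\<close> and the numerators to the product of the
  sizes of all proper subtrees of \<open>T\<close>, so all complete runs are equally likely.\<close>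

section \<open>Forests: root weights, sizes and hook products\<close>

abbreviation forest_subtrees :: "'a ptree list \<Rightarrow> 'a ptree list" where
  "forest_subtrees ts \<equiv> concat (map subtrees ts)"

definition root_weights :: "'a ptree list \<Rightarrow> 'a multiset" where
  "root_weights ts = (\<Sum>t\<leftarrow>ts. replicate_mset (tree_size t) (action t))"

lemma root_weights_simps [simp]:
  "root_weights [] = {#}"
  "root_weights (t # ts) = replicate_mset (tree_size t) (action t) + root_weights ts"
  "root_weights (ts @ us) = root_weights ts + root_weights us"
  by (simp_all add: root_weights_def)

definition forest_size :: "'a ptree list \<Rightarrow> nat" where
  "forest_size ts = (\<Sum>t\<leftarrow>ts. tree_size t)"

lemma forest_size_simps [simp]:
  "forest_size [] = 0"
  "forest_size (t # ts) = tree_size t + forest_size ts"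
  "forest_size (ts @ us) = forest_size ts + forest_size us"
  by (simp_all add: forest_size_def)

lemma tree_size_eq_forest_size: "tree_size (Node a ts) = Suc (forest_size ts)"
  by (simp add: tree_size_Node forest_size_def)

lemma tree_size_pos: "0 < tree_size t"
  by (cases t) (simp add: tree_size_Node)

lemma size_root_weights: "size (root_weights ts) = forest_size ts"
  by (induction ts) auto

lemma forest_size_eq_0_iff: "forest_size ts = 0 \<longleftrightarrow> ts = []"
proof (cases ts)
  case (Cons t us)
  then show ?thesis using tree_size_pos[of t] by simp
qed simp

lemma set_root_weights: "set_mset (root_weights ts) = action ` set ts"
proof (induction ts)
  case (Cons t ts)
  then show ?case using tree_size_pos[of t] by simp
qed simp

text \<open>The denominator of the hook length formula for forests: dividing the factorial of
  \<open>forest_size ts\<close> by it counts the linear extensions of the forest.\<close>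

definition hook_product :: "'a ptree list \<Rightarrow> nat" where
  "hook_product ts = prod_list (map tree_size (forest_subtrees ts))"

lemma hook_product_expand:
  "hook_product (xs @ Node b us # ys) = tree_size (Node b us) * hook_product (xs @ us @ ys)"
  by (simp add: hook_product_def)

section \<open>Weights of nodes and the update of \<open>M\<close>\<close>

lemma self_in_subtrees: "t \<in> set (subtrees t)"
  by (cases t) simp

lemma set_subset_forest: "set ts \<subseteq> set (forest_subtrees ts)"
  by (auto intro: self_in_subtrees)

lemma subtree_at_action:
  assumes "process_tree T" "S \<in> set (subtrees T)"
  shows "subtree_at T (action S) = S"
proof -
  have "inj_on action (set (subtrees T))"
    using assms(1) by (simp add: process_tree_def nodes_def distinct_map)
  then show ?thesis
    unfolding subtree_at_def using assms(2) by (auto dest: inj_onD)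
qed

lemma weight_action:
  "process_tree T \<Longrightarrow> S \<in> set (subtrees T) \<Longrightarrow> weight T (action S) = tree_size S"
  by (simp add: weight_def subtree_at_action)

text \<open>\<open>set_weight\<close> overwrites, but distinct names that are absent from
  \<open>M\<close> have nothing to overwrite, so the fold is a multiset sum.\<close>

lemma fold_set_weight:
  assumes "distinct bs" "set bs \<inter> set_mset M = {}"
  shows "fold (\<lambda>\<beta>. set_weight \<beta> (w \<beta>)) bs M = M + (\<Sum>\<beta>\<leftarrow>bs. replicate_mset (w \<beta>) \<beta>)"
  using assms
proof (induction bs arbitrary: M)
  case (Cons b bs)
  have "set_weight b (w b) M = M + replicate_mset (w b) b"
    using Cons.prems by (auto simp: set_weight_def filter_mset_eq_conv)
  moreover have "set bs \<inter> set_mset (M + replicate_mset (w b) b) = {}"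
    using Cons.prems by auto
  ultimately show ?case
    using Cons.IH[of "M + replicate_mset (w b) b"] Cons.prems by simp
qed simp

text \<open>The old weight \<open>k\<close> of \<open>b\<close> is erased, so it may be arbitrary;
  freshness of the names in \<open>us\<close> makes the insertion of the children additive. This
  covers both the first step and every later one.\<close>

lemma update_add:
  assumes T: "process_tree T" and S: "Node b us \<in> set (subtrees T)"
    and us: "set us \<subseteq> set (subtrees T)" "distinct (map action us)"
    and M: "b \<notin># M" "action ` set us \<inter> set_mset M = {}"
  shows "update T b (replicate_mset k b + M) = M + root_weights us"
proof -
  have "set_weight b 0 (replicate_mset k b + M) = M"
  proof -
    have "filter_mset (\<lambda>x. x \<noteq> b) M = M" using M(1) by (auto simp: filter_mset_eq_conv)
    then show ?thesis by (simp add: set_weight_def)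
  qed
  moreover have "subtree_at T b = Node b us"
    using subtree_at_action[OF T S] by simp
  moreover have "(\<Sum>\<beta>\<leftarrow>map action us. replicate_mset (weight T \<beta>) \<beta>) = root_weights us"
    unfolding root_weights_def map_map comp_def using weight_action[OF T] us(1)
    by (intro arg_cong[where f = sum_list] map_cong) auto
  ultimately show ?thesis
    unfolding update_def using fold_set_weight[of "map action us" M "weight T"] us(2) M(2) by simp
qed

section \<open>The Markov chain of prefixes\<close>

text \<open>The multiset \<open>M\<close> is a function of the prefix \<open>\<sigma>\<close>, so the prefixes alone
  already form a Markov chain.\<close>

definition pending :: "'a ptree \<Rightarrow> 'a list \<Rightarrow> 'a multiset" where
  "pending T \<sigma> = fold (update T) \<sigma> (replicate_mset (tree_size T) (action T))"

lemma pending_snoc: "pending T (\<sigma> @ [\<alpha>]) = update T \<alpha> (pending T \<sigma>)"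
  by (simp add: pending_def)

definition prefix_law :: "'a ptree \<Rightarrow> nat \<Rightarrow> 'a list pmf" where
  "prefix_law T p = map_pmf fst (state_after T p)"

lemma state_after_support:
  "(\<sigma>, M) \<in> set_pmf (state_after T p) \<Longrightarrow> M = pending T \<sigma> \<and> length \<sigma> = p"
proof (induction p arbitrary: \<sigma> M)
  case 0
  then show ?case by (simp add: pending_def)
next
  case (Suc p)
  then show ?case by (fastforce simp: pending_snoc)
qed

lemma prefix_law_0: "prefix_law T 0 = return_pmf []"
  by (simp add: prefix_law_def)

lemma prefix_law_Suc:
  "prefix_law T (Suc p) =
     bind_pmf (prefix_law T p) (\<lambda>\<sigma>. map_pmf (\<lambda>\<alpha>. \<sigma> @ [\<alpha>]) (pmf_of_multiset (pending T \<sigma>)))"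
  unfolding prefix_law_def bind_map_pmf
  by (auto simp: map_bind_pmf map_pmf_comp split_beta dest: state_after_support intro!: bind_pmf_cong)

text \<open>The first step is deterministic, since all the initial weight sits at the root.\<close>

lemma prefix_law_1: "prefix_law T (Suc 0) = return_pmf [action T]"
proof -
  have "set_mset (pending T []) = {action T}" "pending T [] \<noteq> {#}"
    using tree_size_pos[of T] by (auto simp: pending_def)
  then have "set_pmf (pmf_of_multiset (pending T [])) = {action T}" by simp
  then have "pmf_of_multiset (pending T []) = return_pmf (action T)"
    by (metis set_pmf_subset_singleton subset_refl)
  then show ?thesis by (simp add: prefix_law_Suc prefix_law_0 bind_return_pmf)
qed

lemma length_prefix_law: "\<sigma> \<in> set_pmf (prefix_law T p) \<Longrightarrow> length \<sigma> = p"
  by (auto simp: prefix_law_def dest: state_after_support)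

text \<open>Later steps only append, so truncation forgets them. This turns events about prefixes of
  a complete run into masses of \<open>prefix_law\<close>.\<close>

lemma map_take_prefix_law:
  assumes "p \<le> q"
  shows "map_pmf (take p) (prefix_law T q) = prefix_law T p"
  using assms
proof (induction q rule: dec_induct)
  case base
  have "map_pmf (take p) (prefix_law T p) = map_pmf id (prefix_law T p)"
    by (intro map_pmf_cong) (auto dest: length_prefix_law)
  then show ?case by simp
next
  case (step q)
  have "map_pmf (take p) (prefix_law T (Suc q)) =
      bind_pmf (prefix_law T q) (\<lambda>\<sigma>. map_pmf (\<lambda>_. take p \<sigma>) (pmf_of_multiset (pending T \<sigma>)))"
    unfolding prefix_law_Suc map_bind_pmf map_pmf_comp using step(1)
    by (intro bind_pmf_cong map_pmf_cong) (auto dest: length_prefix_law)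
  also have "\<dots> = map_pmf (take p) (prefix_law T q)"
    by (simp add: map_pmf_def[of "take p"])
  finally show ?case using step.IH by simp
qed

lemma pmf_prefix_law_snoc:
  "pmf (prefix_law T (Suc p)) (\<sigma> @ [\<alpha>]) =
     pmf (prefix_law T p) \<sigma> * pmf (pmf_of_multiset (pending T \<sigma>)) \<alpha>"
proof -
  \<comment> \<open>Only \<open>\<rho> = \<sigma>\<close> can be extended to
    \<open>\<sigma> @ [\<alpha>]\<close>, so the integral over \<open>\<rho>\<close> collapses to a
    single mass.\<close>
  have "pmf (map_pmf (\<lambda>\<alpha>. \<rho> @ [\<alpha>]) (pmf_of_multiset (pending T \<rho>))) (\<sigma> @ [\<alpha>]) =
      indicator {\<sigma>} \<rho> * pmf (pmf_of_multiset (pending T \<sigma>)) \<alpha>" for \<rho>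
  proof (cases "\<rho> = \<sigma>")
    case True
    have "inj (\<lambda>\<alpha>. \<sigma> @ [\<alpha>])" by (simp add: inj_def)
    then show ?thesis
      using True pmf_map_inj'[of "\<lambda>\<alpha>. \<sigma> @ [\<alpha>]"] by simp
  next
    case False
    then show ?thesis by (auto simp: pmf_eq_0_set_pmf)
  qed
  then show ?thesis
    unfolding prefix_law_Suc pmf_bind by (simp add: measure_pmf_single)
qed

section \<open>Chains of contractions and concurrent runs\<close>

text \<open>\<open>reach T \<sigma> S\<close>: the contractions at the actions of \<open>\<sigma>\<close> after
  the first one lead from \<open>T\<close> to \<open>S\<close>.\<close>

inductive reach :: "'a ptree \<Rightarrow> 'a list \<Rightarrow> 'a ptree \<Rightarrow> bool" for T where
  start: "reach T [action T] T"
| step: "reach T \<sigma> (Node a (xs @ Node b us # ys)) \<Longrightarrow> reach T (\<sigma> @ [b]) (Node b (xs @ us @ ys))"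

text \<open>Links the index form of \<open>contract\<close> with the list splitting used in
  \<open>reach\<close>.\<close>

lemma contract_split: "contract (Node a (xs @ Node b us # ys)) (length xs) = Node b (xs @ us @ ys)"
  by (simp add: contract_def)

lemma concurrent_runs_rec:
  "concurrent_runs S = (if children S = [] then {[action S]}
     else (\<Union>i<length (children S). (#) (action S) ` concurrent_runs (contract S i)))"
  unfolding concurrent_runs_def by (subst Sem.simps) auto

lemma reach_last: "reach T \<sigma> S \<Longrightarrow> \<sigma> \<noteq> [] \<and> last \<sigma> = action S"
  by (induction rule: reach.induct) auto

lemma reach_contract:
  assumes "reach T \<sigma> S" "i < length (children S)"
  shows "reach T (\<sigma> @ [action (contract S i)]) (contract S i)"
proof -
  obtain a ts where S: "S = Node a ts" by (cases S)
  obtain b us where b: "ts ! i = Node b us" by (cases "ts ! i")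
  have "ts = take i ts @ Node b us # drop (Suc i) ts"
    using id_take_nth_drop[of i ts] assms S b by simp
  then show ?thesis
    using reach.step[of T \<sigma> a "take i ts" b us "drop (Suc i) ts"] assms S b
    by (simp add: contract_def)
qed

text \<open>The induction prolongs \<open>\<tau>\<close> at the front by the root of the preceding
  tree. The last action of \<open>\<sigma>\<close> is the root of \<open>S\<close>, with which
  \<open>\<tau>\<close> also starts; \<open>butlast\<close> avoids listing it twice.\<close>

lemma reach_concurrent_runs:
  "reach T \<sigma> S \<Longrightarrow> \<tau> \<in> concurrent_runs S \<Longrightarrow> butlast \<sigma> @ \<tau> \<in> concurrent_runs T"
proof (induction arbitrary: \<tau> rule: reach.induct)
  case (step \<sigma> a xs b us ys)
  let ?S = "Node a (xs @ Node b us # ys)"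
  have "a # \<tau> \<in> concurrent_runs ?S"
    using step.prems by (subst concurrent_runs_rec)
      (auto intro!: bexI[of _ "length xs"] simp: contract_split)
  then have "butlast \<sigma> @ a # \<tau> \<in> concurrent_runs T" by (rule step.IH)
  then show ?case
    using reach_last[OF step.hyps] append_butlast_last_id[of \<sigma>]
    by (metis append.assoc append_Cons append_Nil butlast_snoc ptree.sel(1))
qed simp

text \<open>Follows a branch of \<open>Sem S\<close> downwards by the recursion of
  \<open>Sem\<close>; each child on the way is one more contraction, and the branch ends at a tree
  with nothing left to contract.\<close>

lemma concurrent_runs_reach:
  "reach T (\<rho> @ [action S]) S \<Longrightarrow> \<tau> \<in> concurrent_runs S \<Longrightarrow>
     \<exists>S'. reach T (\<rho> @ \<tau>) S' \<and> children S' = []"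
proof (induction S arbitrary: \<rho> \<tau> rule: Sem.induct)
  case (1 S)
  show ?case
  proof (cases "children S = []")
    case True
    then show ?thesis using 1(2,3) concurrent_runs_rec[of S] by auto
  next
    case False
    then obtain i \<tau>' where i: "i < length (children S)" "\<tau>' \<in> concurrent_runs (contract S i)"
      "\<tau> = action S # \<tau>'"
      using 1(3) concurrent_runs_rec[of S] by auto
    then show ?thesis
      using 1(1)[of i "\<rho> @ [action S]" \<tau>'] reach_contract[OF 1(2)] by auto
  qed
qed

lemma concurrent_runs_eq: "concurrent_runs T = {\<sigma>. \<exists>S. reach T \<sigma> S \<and> children S = []}"
proof (intro equalityI subsetI)
  fix \<sigma> assume "\<sigma> \<in> concurrent_runs T"
  then show "\<sigma> \<in> {\<sigma>. \<exists>S. reach T \<sigma> S \<and> children S = []}"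
    using concurrent_runs_reach[of T "[]" T \<sigma>] reach.start[of T] by simp
next
  fix \<sigma> assume "\<sigma> \<in> {\<sigma>. \<exists>S. reach T \<sigma> S \<and> children S = []}"
  then obtain S where S: "reach T \<sigma> S" "children S = []" by auto
  then have "butlast \<sigma> @ [action S] \<in> concurrent_runs T"
    using reach_concurrent_runs[OF S(1)] concurrent_runs_rec[of S] by simp
  then show "\<sigma> \<in> concurrent_runs T"
    using reach_last[OF S(1)] by (metis append_butlast_last_id)
qed

section \<open>Invariants along a chain of contractions\<close>

text \<open>A contraction at \<open>b\<close> dissolves only the subtree rooted at \<open>b\<close>;
  all others below the root stay whole and keep the weights they have in \<open>T\<close>.
  \<open>S\<close> itself need not be a subtree of \<open>T\<close>.\<close>

lemma reach_subtrees:
  "reach T \<sigma> S \<Longrightarrow> set (forest_subtrees (children S)) \<subseteq> set (subtrees T)"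
  by (induction rule: reach.induct) (cases T, auto)

lemma reach_distinct:
  "reach T \<sigma> S \<Longrightarrow> process_tree T \<Longrightarrow> distinct (map action (forest_subtrees (children S)))"
proof (induction rule: reach.induct)
  case start
  then show ?case by (cases T) (simp add: process_tree_def nodes_def)
qed auto

lemma reach_length: "reach T \<sigma> S \<Longrightarrow> length \<sigma> + forest_size (children S) = tree_size T"
proof (induction rule: reach.induct)
  case start
  then show ?case by (cases T) (simp add: tree_size_eq_forest_size)
qed (simp add: tree_size_eq_forest_size)

lemma distinct_roots: "distinct (map action (forest_subtrees ts)) \<Longrightarrow> distinct (map action ts)"
proof (induction ts)
  case (Cons t ts)
  have "distinct (map action ts)" using Cons by simp
  moreover have "action t \<notin> action ` set ts"
    using Cons.prems self_in_subtrees[of t] set_subset_forest[of ts] by (auto simp: disjoint_iff)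
  ultimately show ?case by simp
qed simp

lemma reach_pending:
  assumes "reach T \<sigma> S" and T: "process_tree T"
  shows "pending T \<sigma> = root_weights (children S)"
  using assms(1)
proof (induction rule: reach.induct)
  case start
  obtain a ts where [simp]: "T = Node a ts" by (cases T)
  have d: "distinct (a # map action (forest_subtrees ts))"
    using T by (simp add: process_tree_def nodes_def)
  \<comment> \<open>The initial multiset holds the root alone, hence the empty remainder.\<close>
  have "update T a (replicate_mset (tree_size T) a + {#}) = {#} + root_weights ts"
    using T self_in_subtrees[of T] set_subset_forest[of ts] d distinct_roots[of ts]
    by (intro update_add) auto
  then show ?case by (simp add: pending_def)
next
  case (step \<sigma> a xs b us ys)
  let ?ts = "xs @ Node b us # ys"
  let ?M = "root_weights (xs @ ys)"
  have d: "distinct (map action (forest_subtrees ?ts))"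
    and sub: "set (forest_subtrees ?ts) \<subseteq> set (subtrees T)"
    using reach_distinct[OF step.hyps T] reach_subtrees[OF step.hyps] by simp_all
  have "action ` set us \<subseteq> action ` set (forest_subtrees us)"
    "action ` set (xs @ ys) \<subseteq> action ` set (forest_subtrees (xs @ ys))"
    using set_subset_forest by blast+
  \<comment> \<open>Distinct names separate the tree at \<open>b\<close> from its siblings, which
    gives the freshness that \<open>update_add\<close> requires.\<close>
  moreover have "insert b (action ` set (forest_subtrees us)) \<inter>
      action ` set (forest_subtrees (xs @ ys)) = {}"
    using d by (auto simp del: set_concat)
  ultimately have M: "b \<notin># ?M" "action ` set us \<inter> set_mset ?M = {}"
    unfolding set_root_weights by blast+
  have "update T b (replicate_mset (tree_size (Node b us)) b + ?M) = ?M + root_weights us"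
    using set_subset_forest[of us] sub d distinct_roots[of us] by (intro update_add T M) auto
  then show ?case
    using step.IH by (simp add: pending_snoc ac_simps)
qed

text \<open>Sibling roots have distinct names, so no two of them contribute to the same
  count.\<close>

lemma reach_count:
  assumes "reach T \<sigma> S" "process_tree T" "t \<in> set (children S)"
  shows "count (pending T \<sigma>) (action t) = tree_size t"
proof -
  have "distinct (map action ts) \<Longrightarrow> t \<in> set ts \<Longrightarrow>
      count (root_weights ts) (action t) = tree_size t" for ts
  proof (induction ts)
    case (Cons s ts)
    have "action s \<notin> action ` set ts" using Cons.prems by simp
    then have "count (root_weights ts) (action s) = 0"
      using set_root_weights[of ts] by (simp add: count_eq_zero_iff)
    with Cons \<open>action s \<notin> action ` set ts\<close> show ?case by (cases "t \<in> set ts") (auto simp: image_iff)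
  qed simp
  from this[of "children S"] show ?thesis
    using reach_pending[OF assms(1,2)] distinct_roots[OF reach_distinct[OF assms(1,2)]] assms(3)
    by simp
qed

lemma reach_pmf_pending:
  assumes "reach T \<sigma> S" "process_tree T" "t \<in> set (children S)"
  shows "pmf (pmf_of_multiset (pending T \<sigma>)) (action t) = tree_size t / forest_size (children S)"
proof -
  have "pending T \<sigma> \<noteq> {#}"
    using reach_count[OF assms] tree_size_pos[of t] by auto
  then show ?thesis
    using reach_count[OF assms] by (simp add: reach_pending[OF assms(1,2)] size_root_weights)
qed

section \<open>Support of the prefix law\<close>

text \<open>Drawing from \<open>M\<close> and contracting offer the same choices: the roots of the
  root-subtrees. The index is \<open>Suc p\<close> because \<open>reach\<close> starts with the root
  already executed.\<close>

lemma set_prefix_law: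
  assumes T: "process_tree T" and "p < tree_size T"
  shows "set_pmf (prefix_law T (Suc p)) = {\<sigma>. length \<sigma> = Suc p \<and> (\<exists>S. reach T \<sigma> S)}"
  using assms(2)
proof (induction p)
  case 0
  \<comment> \<open>The rule \<open>step\<close> would need an empty prefix, which
    \<open>reach_last\<close> excludes.\<close>
  have "\<sigma> = [action T]" if "reach T \<sigma> S" "length \<sigma> = Suc 0" for \<sigma> S
    using that by (cases rule: reach.cases) (auto dest: reach_last)
  then show ?case using reach.start[of T] by (fastforce simp: prefix_law_1)
next
  case (Suc p)
  have next_action: "set_pmf (pmf_of_multiset (pending T \<rho>)) = action ` set (children S)"
    if "reach T \<rho> S" "length \<rho> = Suc p" for \<rho> S
  proof -
    \<comment> \<open>The length bound keeps \<open>M\<close> nonempty; only then is the support of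
      \<open>pmf_of_multiset\<close> that of \<open>M\<close>.\<close>
    have "forest_size (children S) \<noteq> 0" using reach_length[OF that(1)] that(2) Suc.prems by simp
    then have "pending T \<rho> \<noteq> {#}"
      using reach_pending[OF that(1) T] size_root_weights[of "children S"] by auto
    then show ?thesis
      by (simp add: reach_pending[OF that(1) T] set_root_weights)
  qed
  have IH: "set_pmf (prefix_law T (Suc p)) = {\<sigma>. length \<sigma> = Suc p \<and> (\<exists>S. reach T \<sigma> S)}"
    using Suc by simp
  show ?case
  proof (intro equalityI subsetI)
    fix \<sigma> assume "\<sigma> \<in> set_pmf (prefix_law T (Suc (Suc p)))"
    then obtain \<rho> S \<alpha> where \<rho>: "\<sigma> = \<rho> @ [\<alpha>]" "length \<rho> = Suc p" "reach T \<rho> S"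
      "\<alpha> \<in> set_pmf (pmf_of_multiset (pending T \<rho>))"
      unfolding prefix_law_Suc[of T "Suc p"] using IH by auto
    then obtain t where t: "t \<in> set (children S)" "\<alpha> = action t" using next_action by auto
    then obtain xs ys where "children S = xs @ t # ys" by (meson split_list)
    then have "S = Node (action S) (xs @ Node \<alpha> (children t) # ys)"
      using t(2) by (metis ptree.collapse)
    then have "reach T (\<rho> @ [\<alpha>]) (Node \<alpha> (xs @ children t @ ys))"
      using \<rho>(3) reach.step by metis
    then show "\<sigma> \<in> {\<sigma>. length \<sigma> = Suc (Suc p) \<and> (\<exists>S. reach T \<sigma> S)}" using \<rho> by auto
  next
    fix \<sigma> assume "\<sigma> \<in> {\<sigma>. length \<sigma> = Suc (Suc p) \<and> (\<exists>S. reach T \<sigma> S)}"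
    then obtain S where S: "length \<sigma> = Suc (Suc p)" "reach T \<sigma> S" by auto
    from S(2,1) show "\<sigma> \<in> set_pmf (prefix_law T (Suc (Suc p)))"
    proof (cases rule: reach.cases)
      case (step \<rho> a xs b us ys)
      have "\<rho> \<in> set_pmf (prefix_law T (Suc p))" using step S(1) IH by auto
      moreover have "b \<in> set_pmf (pmf_of_multiset (pending T \<rho>))"
        using next_action[OF step(3)] step(1) S(1) by simp
      ultimately show ?thesis
        unfolding prefix_law_Suc[of T "Suc p"] step(1) by auto
    qed simp
  qed
qed

section \<open>Probability of a run and uniformity\<close>

text \<open>Each contraction divides the hook product by the weight of the chosen node, so the product
  of the transition probabilities telescopes.\<close>

lemma pmf_prefix_law_reach:
  assumes "reach T \<sigma> S" and T: "process_tree T"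
  shows "pmf (prefix_law T (length \<sigma>)) \<sigma> * fact (tree_size T - 1) * hook_product (children S) =
           hook_product (children T) * fact (forest_size (children S))"
  using assms(1)
proof (induction rule: reach.induct)
  case start
  obtain a ts where [simp]: "T = Node a ts" by (cases T)
  show ?case by (simp add: prefix_law_1 tree_size_eq_forest_size)
next
  case (step \<sigma> a xs b us ys)
  let ?ts = "xs @ Node b us # ys" and ?ts' = "xs @ us @ ys"
  let ?P = "pmf (prefix_law T (length \<sigma>)) \<sigma>" and ?w = "real (tree_size (Node b us))"
  have n: "forest_size ?ts = Suc (forest_size ?ts')" by (simp add: tree_size_eq_forest_size)
  have fact_step: "real (fact (forest_size ?ts)) =
      real (forest_size ?ts) * real (fact (forest_size ?ts'))"
    unfolding n by (simp only: fact_Suc of_nat_mult of_nat_id)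
  have P: "pmf (prefix_law T (length (\<sigma> @ [b]))) (\<sigma> @ [b]) = ?P * (?w / forest_size ?ts)"
    using reach_pmf_pending[OF step.hyps T, of "Node b us"] by (simp add: pmf_prefix_law_snoc)
  have "?P * fact (tree_size T - 1) * (?w * hook_product ?ts') =
      hook_product (children T) * (forest_size ?ts * fact (forest_size ?ts'))"
    using step.IH unfolding ptree.sel fact_step hook_product_expand of_nat_mult .
  \<comment> \<open>The cancellation in isolation: \<open>w\<close> is the weight of
    \<open>b\<close>, and \<open>k\<close> is the total weight, nonzero by \<open>n\<close>.\<close>
  moreover have "p * (w / k) * F * h = h0 * f"
    if "p * F * (w * h) = h0 * (k * f)" "k \<noteq> 0" for p w k F h h0 f :: real
    using that by (simp add: field_simps)
  ultimately show ?case
    unfolding P ptree.sel using n by simp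
qed

text \<open>The masses sum to one over a finite support, which forces \<open>c\<close> to be the
  reciprocal of its cardinality.\<close>

lemma pmf_of_set_if_constant:
  assumes "finite (set_pmf p)" "\<And>x. x \<in> set_pmf p \<Longrightarrow> pmf p x = c"
  shows "p = pmf_of_set (set_pmf p)"
proof (rule pmf_eqI)
  fix x
  have "(\<Sum>x\<in>set_pmf p. pmf p x) = 1" using assms(1) by (rule sum_pmf_eq_1) simp
  then have "c * card (set_pmf p) = 1" using assms(2) by (simp add: mult.commute)
  moreover from this have "real (card (set_pmf p)) \<noteq> 0" by (metis mult_zero_right zero_neq_one)
  ultimately have "c = 1 / card (set_pmf p)" by (simp only: eq_divide_eq) simp
  then show "pmf p x = pmf (pmf_of_set (set_pmf p)) x"
    using assms by (simp add: set_pmf_not_empty indicator_def pmf_eq_0_set_pmf)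
qed

lemma finite_branches: "finite (branches t)"
  by (induction t rule: branches.induct) auto

lemma random_run_eq_prefix_law: "random_run T = prefix_law T (tree_size T)"
  by (simp add: random_run_def prefix_law_def)

lemma random_run_uniform:
  assumes T: "process_tree T"
  shows "random_run T = pmf_of_set (concurrent_runs T)"
proof -
  have "length \<sigma> = tree_size T \<longleftrightarrow> children S = []" if "reach T \<sigma> S" for \<sigma> S
    using reach_length[OF that] forest_size_eq_0_iff[of "children S"] by auto
  then have set: "set_pmf (random_run T) = concurrent_runs T"
    unfolding random_run_eq_prefix_law concurrent_runs_eq
    using set_prefix_law[OF T, of "tree_size T - 1"] tree_size_pos[of T] by auto
  \<comment> \<open>When no children remain, the hook product and the factorial on the side of
    \<open>S\<close> are both 1, leaving a value independent of \<open>\<sigma>\<close>.\<close>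
  have "pmf (random_run T) \<sigma> = hook_product (children T) / fact (tree_size T - 1)"
    if \<sigma>: "\<sigma> \<in> set_pmf (random_run T)" for \<sigma>
  proof -
    obtain S where S: "reach T \<sigma> S" "children S = []"
      using \<sigma> unfolding set concurrent_runs_eq by auto
    then have "length \<sigma> = tree_size T" using reach_length[OF S(1)] by simp
    then show ?thesis
      using pmf_prefix_law_reach[OF S(1) T] S(2)
      by (simp add: random_run_eq_prefix_law hook_product_def field_simps)
  qed
  then show ?thesis
    using pmf_of_set_if_constant[of "random_run T"] finite_branches[of "Sem T"]
    by (simp add: set concurrent_runs_def)
qed

section \<open>Conditional law of the next action\<close>

text \<open>The conditional probability is a quotient of masses of two consecutive prefix laws, that
  is, one transition probability of the chain.\<close>

lemma cond_prob_next_action: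
  assumes T: "process_tree T" and p: "1 \<le> p" "p < tree_size T"
    and st: "(\<sigma>\<^sub>p, M) \<in> set_pmf (state_after T p)" and \<alpha>: "\<alpha> \<in># M"
  shows "\<P>(\<sigma> in random_run T. \<sigma> ! p = \<alpha> \<bar> take p \<sigma> = \<sigma>\<^sub>p) =
           real (weight T \<alpha>) / (real (tree_size T) - real p)"
proof -
  have M: "M = pending T \<sigma>\<^sub>p" and len: "length \<sigma>\<^sub>p = p" using state_after_support[OF st] by auto
  have in_supp: "\<sigma>\<^sub>p \<in> set_pmf (prefix_law T p)" using imageI[OF st, of fst] by (simp add: prefix_law_def)
  then obtain S where S: "reach T \<sigma>\<^sub>p S" using set_prefix_law[OF T, of "p - 1"] p by auto
  obtain t where t: "t \<in> set (children S)" "\<alpha> = action t"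
    using \<alpha> unfolding M reach_pending[OF S T] set_root_weights by auto
  have "t \<in> set (subtrees T)" using t(1) reach_subtrees[OF S] set_subset_forest[of "children S"] by blast
  then have w: "weight T \<alpha> = tree_size t" using t(2) weight_action[OF T] by simp
  \<comment> \<open>The event is the preimage of \<open>\<tau>\<close> under
    \<open>take q\<close>.\<close>
  have prob: "measure_pmf.prob (random_run T) {\<sigma>. take q \<sigma> = \<tau>} = pmf (prefix_law T q) \<tau>"
    if "q \<le> tree_size T" for q \<tau>
    unfolding random_run_eq_prefix_law map_take_prefix_law[OF that, symmetric] pmf_map
    by (simp add: vimage_def)
  \<comment> \<open>Positions count from 0, so \<open>\<sigma> ! p\<close> is the action of step
    \<open>p + 1\<close>. The events are compared only on the support, where runs are long enough
    for this entry to exist.\<close>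
  have "measure_pmf.prob (random_run T) {\<sigma>. \<sigma> ! p = \<alpha> \<and> take p \<sigma> = \<sigma>\<^sub>p} =
      measure_pmf.prob (random_run T) {\<sigma>. take (Suc p) \<sigma> = \<sigma>\<^sub>p @ [\<alpha>]}"
  proof (intro measure_pmf.finite_measure_eq_AE AE_pmfI)
    fix \<sigma> assume "\<sigma> \<in> set_pmf (random_run T)"
    then have "p < length \<sigma>"
      using p(2) by (simp add: random_run_eq_prefix_law length_prefix_law)
    then have "take (Suc p) \<sigma> = take p \<sigma> @ [\<sigma> ! p]" by (rule take_Suc_conv_app_nth)
    then show "\<sigma> \<in> {\<sigma>. \<sigma> ! p = \<alpha> \<and> take p \<sigma> = \<sigma>\<^sub>p} \<longleftrightarrow>
        \<sigma> \<in> {\<sigma>. take (Suc p) \<sigma> = \<sigma>\<^sub>p @ [\<alpha>]}" by auto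
  qed simp_all
  also have "\<dots> = pmf (prefix_law T p) \<sigma>\<^sub>p * (real (tree_size t) / real (forest_size (children S)))"
    using prob[of "Suc p"] p(2) reach_pmf_pending[OF S T t(1)] t(2) by (simp add: pmf_prefix_law_snoc)
  \<comment> \<open>The prefix lies in the support, so its mass is positive and cancels.\<close>
  finally have "\<P>(\<sigma> in random_run T. \<sigma> ! p = \<alpha> \<bar> take p \<sigma> = \<sigma>\<^sub>p) =
      real (tree_size t) / real (forest_size (children S))"
    using prob[of p] p(2) in_supp by (simp add: cond_prob_def set_pmf_iff)
  moreover have "real (forest_size (children S)) = real (tree_size T) - real p"
    using reach_length[OF S] len by simp
  ultimately show ?thesis using w by simp
qed

theorem proposition39:
  fixes T :: "'a ptree"
  assumes "process_tree T"
  shows "(\<forall>p \<sigma>\<^sub>p M \<alpha>. 1 \<le> p \<and> p < tree_size T \<and>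
            (\<sigma>\<^sub>p, M) \<in> set_pmf (state_after T p) \<and> \<alpha> \<in># M \<longrightarrow>
            \<P>(\<sigma> in random_run T. \<sigma> ! p = \<alpha> \<bar> take p \<sigma> = \<sigma>\<^sub>p) =
              real (weight T \<alpha>) / (real (tree_size T) - real p)) \<and>
         random_run T = pmf_of_set (concurrent_runs T)"
  using cond_prob_next_action[OF assms] random_run_uniform[OF assms] by blast

end
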